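(* $\mathfrak{e}_{ubd}\leq\mathrm{non}(\mathcal{MA})$.
   Context: For $b\in\omega^\omega$ with $b(n)\geq2$: $\prod b=\prod_nb(n)$ and $\mathrm{Seq}_{<\omega}(b)=\bigcup_n\prod_{i<n}b(i)$. A pair $(D,\pi)$ with $D\in[\omega]^\omega$ and $\pi$ a function on $\mathrm{Seq}_{<\omega}(b)$ assigning to each $\sigma\in\prod_{i<n}b(i)$ an element $\pi(\sigma)\in b(n)$ predicts $f\in\prod b$ if $f(n)=\pi(f\restriction n)$ for all but finitely many $n\in D$. $\mathfrak{e}^{\mathrm{L}}_{b,1}$ is the least size of $F\subseteq\prod b$ such that no single such pair predicts all members of $F$, and $\mathfrak{e}_{ubd}=\min\{\mathfrak{e}^{\mathrm{L}}_{b,1}:b\in\omega^\omega\}$. Identify $2^\omega$ with the group $(\mathbb{Z}/2\mathbb{Z})^\omega$; $X\subseteq2^\omega$ is meager-additive if $A+X$ is meager for every meager $A\subseteq2^\omega$. $\mathcal{MA}$ is the ideal of meager-additive sets and $\mathrm{non}(\mathcal{MA})$ is the least size of a subset of $2^\omega$ not in $\mathcal{MA}$. *)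

theory Defs
  imports "HOL-Analysis.Analysis" "HOL-Library.Z2"
begin

unbundle cardinal_syntax

text \<open>Cardinals are represented by cardinal orders, up to \<open>=o\<close>. Below, \<open>min_card\<close> is only applied
  to nonempty sets of cardinals, where the minimum exists (see the lemmas at the end).\<close>

definition min_card :: "'a rel set \<Rightarrow> 'a rel" where
  "min_card R = (SOME r. r \<in> R \<and> (\<forall>s\<in>R. r \<le>o s))"

text \<open>A natural number \<open>k\<close> is identified with \<open>{..<k}\<close>, and a finite sequence \<open>\<sigma>\<close> in
  \<open>\<Prod>i<n. b i\<close> with the list of its values.\<close>

definition Prod_seq :: "(nat \<Rightarrow> nat) \<Rightarrow> (nat \<Rightarrow> nat) set" where
  "Prod_seq b = {f. \<forall>n. f n < b n}"

definition Seq_fin :: "(nat \<Rightarrow> nat) \<Rightarrow> nat list set" where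
  "Seq_fin b = {\<sigma>. \<forall>i<length \<sigma>. \<sigma> ! i < b i}"

definition restr :: "(nat \<Rightarrow> nat) \<Rightarrow> nat \<Rightarrow> nat list" where
  "restr f n = map f [0..<n]"

definition predictor :: "(nat \<Rightarrow> nat) \<Rightarrow> nat set \<times> (nat list \<Rightarrow> nat) \<Rightarrow> bool" where
  "predictor b = (\<lambda>(D, \<pi>). infinite D \<and> (\<forall>\<sigma>\<in>Seq_fin b. \<pi> \<sigma> < b (length \<sigma>)))"

definition predicts :: "nat set \<times> (nat list \<Rightarrow> nat) \<Rightarrow> (nat \<Rightarrow> nat) \<Rightarrow> bool" where
  "predicts = (\<lambda>(D, \<pi>) f. finite {n \<in> D. f n \<noteq> \<pi> (restr f n)})"

definition e_L1 :: "(nat \<Rightarrow> nat) \<Rightarrow> (nat \<Rightarrow> nat) rel" where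
  "e_L1 b = min_card {|F| | F. F \<subseteq> Prod_seq b \<and> \<not> (\<exists>p. predictor b p \<and> (\<forall>f\<in>F. predicts p f))}"

definition e_ubd :: "(nat \<Rightarrow> nat) rel" where
  "e_ubd = min_card {e_L1 b | b. \<forall>n. 2 \<le> b n}"

definition nowhere_dense_in :: "'a topology \<Rightarrow> 'a set \<Rightarrow> bool" where
  "nowhere_dense_in T N \<longleftrightarrow> N \<subseteq> topspace T \<and> T interior_of (T closure_of N) = {}"

definition meager_in :: "'a topology \<Rightarrow> 'a set \<Rightarrow> bool" where
  "meager_in T A \<longleftrightarrow> (\<exists>\<N>. countable \<N> \<and> (\<forall>N\<in>\<N>. nowhere_dense_in T N) \<and> A = \<Union>\<N>)"

text \<open>\<open>bit\<close> is the field with two elements, so \<open>nat \<Rightarrow> bit\<close> carries the group \<open>(\<int>/2\<int>)\<^sup>\<omega>\<close>.\<close>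

definition cantor :: "(nat \<Rightarrow> bit) topology" where
  "cantor = product_topology (\<lambda>_. discrete_topology UNIV) UNIV"

definition set_add :: "(nat \<Rightarrow> bit) set \<Rightarrow> (nat \<Rightarrow> bit) set \<Rightarrow> (nat \<Rightarrow> bit) set" where
  "set_add A X = {\<lambda>n. a n + x n | a x. a \<in> A \<and> x \<in> X}"

definition MA :: "(nat \<Rightarrow> bit) set set" where
  "MA = {X. \<forall>A. meager_in cantor A \<longrightarrow> meager_in cantor (set_add A X)}"

definition non :: "'a set set \<Rightarrow> 'a rel" where
  "non \<I> = min_card {|X| | X. X \<notin> \<I>}"

lemma min_card_least:
  assumes "R \<noteq> {}" and "\<And>r. r \<in> R \<Longrightarrow> Well_order r"
  shows "min_card R \<in> R \<and> (\<forall>s\<in>R. min_card R \<le>o s)"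
proof -
  have "\<exists>r. r \<in> R \<and> (\<forall>s\<in>R. r \<le>o s)"
    using exists_minim_Well_order[of R] assms by blast
  then show ?thesis
    unfolding min_card_def by (rule someI_ex)
qed

lemma Prod_seq_not_predicted:
  assumes b: "\<forall>n. 2 \<le> b n"
  shows "\<not> (\<exists>p. predictor b p \<and> (\<forall>f\<in>Prod_seq b. predicts p f))"
proof
  assume "\<exists>p. predictor b p \<and> (\<forall>f\<in>Prod_seq b. predicts p f)"
  then obtain D \<pi> where D: "infinite D" and *: "\<And>f. f \<in> Prod_seq b \<Longrightarrow> predicts (D, \<pi>) f"
    by (auto simp: predictor_def)
  define s where "s = rec_nat [] (\<lambda>_ xs. xs @ [if \<pi> xs = 0 then 1 else 0 :: nat])"
  define f where "f n = (if \<pi> (s n) = 0 then 1 else 0 :: nat)" for n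
  have "restr f n = s n" for n
    by (induction n) (auto simp: restr_def s_def f_def)
  then have "f n \<noteq> \<pi> (restr f n)" for n
    by (simp add: f_def)
  moreover have "f n < b n" for n
    using b[rule_format, of n] by (simp add: f_def)
  ultimately show False
    using *[of f] D by (simp add: predicts_def Prod_seq_def)
qed

lemma e_L1_least:
  assumes "\<forall>n. 2 \<le> b n"
  defines "R \<equiv> {|F| | F. F \<subseteq> Prod_seq b \<and> \<not> (\<exists>p. predictor b p \<and> (\<forall>f\<in>F. predicts p f))}"
  shows "e_L1 b \<in> R \<and> (\<forall>s\<in>R. e_L1 b \<le>o s)"
  unfolding e_L1_def R_def
proof (rule min_card_least)
  show "{|F| | F. F \<subseteq> Prod_seq b \<and> \<not> (\<exists>p. predictor b p \<and> (\<forall>f\<in>F. predicts p f))} \<noteq> {}"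
    using Prod_seq_not_predicted[OF assms(1)] by blast
qed (auto intro: card_of_Well_order)

lemma e_ubd_least:
  defines "R \<equiv> {e_L1 b | b. \<forall>n. 2 \<le> b n}"
  shows "e_ubd \<in> R \<and> (\<forall>s\<in>R. e_ubd \<le>o s)"
  unfolding e_ubd_def R_def
proof (rule min_card_least)
  show "{e_L1 b | b. \<forall>n. 2 \<le> b n} \<noteq> {}"
    by (auto intro!: exI[of _ "\<lambda>_. 2"])
  show "Well_order r" if r: "r \<in> {e_L1 b | b. \<forall>n. 2 \<le> b n}" for r
  proof -
    obtain b where b: "\<forall>n. 2 \<le> b n" "r = e_L1 b"
      using r by blast
    have "e_L1 b \<in> {|F| | F. F \<subseteq> Prod_seq b \<and> \<not> (\<exists>p. predictor b p \<and> (\<forall>f\<in>F. predicts p f))}"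
      using e_L1_least[OF b(1)] by (rule conjunct1)
    then show ?thesis
      unfolding b(2) by (elim CollectE exE conjE) (simp only: card_of_Well_order)
  qed
qed

lemma topspace_cantor: "topspace cantor = UNIV"
  by (simp add: cantor_def)

lemma zero_nowhere_dense: "nowhere_dense_in cantor {\<lambda>_. 0}"
proof -
  have haus: "Hausdorff_space cantor"
    by (simp add: cantor_def Hausdorff_space_product_topology Hausdorff_space_discrete_topology)
  then have "closedin cantor {\<lambda>_. 0}"
    by (simp add: closedin_Hausdorff_singleton topspace_cantor)
  moreover have "cantor interior_of {\<lambda>_. 0} = {}"
  proof (rule ccontr)
    assume "cantor interior_of {\<lambda>_. 0} \<noteq> {}"
    then obtain U where U: "openin cantor U" "(\<lambda>_. 0) \<in> U" "U \<subseteq> {\<lambda>_. 0}"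
      unfolding interior_of_def by auto
    then obtain W where W: "finite {i. W i \<noteq> (UNIV::bit set)}" "(\<lambda>_. 0) \<in> Pi\<^sub>E UNIV W" "Pi\<^sub>E UNIV W \<subseteq> U"
      unfolding cantor_def openin_product_topology_alt by force
    then obtain k where k: "W k = UNIV"
      using infinite_UNIV_nat by (metis (mono_tags, lifting) UNIV_eq_I mem_Collect_eq)
    have "(\<lambda>i. if i = k then 1 else 0) \<in> Pi\<^sub>E UNIV W"
      using W(2) k by (auto simp: PiE_def Pi_def)
    then have "(\<lambda>i. if i = k then 1 else 0 :: bit) = (\<lambda>_. 0)"
      using W(3) U(3) by blast
    from fun_cong[OF this, of k] show False
      by simp
  qed
  ultimately show ?thesis
    by (simp add: nowhere_dense_in_def topspace_cantor closure_of_closedin)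
qed

lemma UNIV_not_meager: "\<not> meager_in cantor UNIV"
proof
  assume "meager_in cantor UNIV"
  then obtain \<N> where N: "countable \<N>" "\<And>N. N \<in> \<N> \<Longrightarrow> nowhere_dense_in cantor N" "UNIV = \<Union>\<N>"
    by (auto simp: meager_in_def)
  have comp: "compact_space cantor"
  proof -
    have "(UNIV :: bit set) \<subseteq> {0, 1}"
      using bit.exhaust by blast
    then have "finite (UNIV :: bit set)"
      using finite_subset by blast
    then show ?thesis
      by (simp add: cantor_def compact_space_product_topology compact_space_discrete_topology)
  qed
  have haus: "Hausdorff_space cantor"
    by (simp add: cantor_def Hausdorff_space_product_topology Hausdorff_space_discrete_topology)
  have "cantor interior_of \<Union>((closure_of) cantor ` \<N>) = {}"
  proof (rule Baire_category_alt)
    show "completely_metrizable_space cantor \<or> locally_compact_space cantor \<and> regular_space cantor"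
      using comp haus compact_imp_locally_compact_space compact_Hausdorff_imp_regular_space by blast
  qed (use N in \<open>auto simp: nowhere_dense_in_def\<close>)
  moreover have "\<Union>((closure_of) cantor ` \<N>) = UNIV"
  proof -
    have "\<Union>\<N> \<subseteq> \<Union>((closure_of) cantor ` \<N>)"
      by (rule Union_least, rule UN_upper[THEN order_trans[rotated]])
        (auto intro: closure_of_subset[THEN subsetD] simp: topspace_cantor)
    then show ?thesis
      unfolding N(3)[symmetric] by (rule top.extremum_uniqueI)
  qed
  ultimately have "cantor interior_of (UNIV :: (nat \<Rightarrow> bit) set) = {}"
    by (simp only:)
  moreover have "cantor interior_of (UNIV :: (nat \<Rightarrow> bit) set) = UNIV"
    using interior_of_topspace[of cantor] unfolding topspace_cantor .
  ultimately show False
    using UNIV_not_empty by metis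
qed

lemma UNIV_notin_MA: "UNIV \<notin> MA"
proof -
  have "meager_in cantor {\<lambda>_. 0}"
    unfolding meager_in_def using zero_nowhere_dense by (intro exI[of _ "{{\<lambda>_. 0}}"]) auto
  moreover have "set_add {\<lambda>_. 0} UNIV = UNIV"
  proof -
    have "\<exists>a y. x = (\<lambda>n. a n + y n) \<and> a \<in> {\<lambda>_. 0} \<and> y \<in> UNIV" for x :: "nat \<Rightarrow> bit"
      by (rule exI[of _ "\<lambda>_. 0"], rule exI[of _ x]) (simp only: add_0 singleton_iff UNIV_I simp_thms)
    then show ?thesis
      unfolding set_add_def by blast
  qed
  ultimately show ?thesis
    using UNIV_not_meager by (auto simp: MA_def)
qed

lemma non_MA_least:
  defines "R \<equiv> {|X| | X. X \<notin> MA}"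
  shows "non MA \<in> R \<and> (\<forall>s\<in>R. non MA \<le>o s)"
  unfolding non_def R_def
proof (rule min_card_least)
  show "{|X| | X. X \<notin> MA} \<noteq> {}"
    using UNIV_notin_MA by blast
qed (auto intro: card_of_Well_order)

end

theory Submission
  imports Defs
begin

text \<open>A meager set \<open>A\<close> is contained in the set of all \<open>z\<close> that differ from some fixed \<open>w\<close> on almost
  all blocks \<open>I\<^sub>k\<close> of an interval partition. Group the \<open>I\<^sub>k\<close> into consecutive superblocks \<open>L\<^sub>n\<close> such
  that \<open>L\<^sub>n\<close> contains at least as many \<open>I\<^sub>k\<close> as there are binary sequences of length \<open>min L\<^sub>n\<close>, and
  code \<open>x \<in> 2\<^sup>\<omega>\<close> by the sequence of its restrictions to the \<open>L\<^sub>n\<close>. If the codes of the members of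
  \<open>X\<close> are predicted by \<open>(D, \<pi>)\<close>, assign to every possible past \<open>p\<close> at \<open>n \<in> D\<close> its own \<open>I\<^sub>k \<subseteq> L\<^sub>n\<close>
  and let \<open>y\<close> be there what \<open>\<pi>\<close> predicts from \<open>p\<close>. This \<open>y\<close> no longer depends on the past, and every
  \<open>x \<in> X\<close> agrees with \<open>y\<close> on some \<open>I\<^sub>k \<subseteq> L\<^sub>n\<close> for almost all \<open>n \<in> D\<close>. Hence every element of
  \<open>A + X\<close> differs from \<open>w + y\<close> on \<open>L\<^sub>n\<close> for almost all \<open>n \<in> D\<close>, and \<open>A + X\<close> is meager.\<close>

section \<open>Cylinders, nowhere dense sets and meager sets in Cantor space\<close>

definition cyl :: "(nat \<Rightarrow> bit) \<Rightarrow> nat \<Rightarrow> (nat \<Rightarrow> bit) set" where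
  "cyl u n = {z. \<forall>i<n. z i = u i}"

lemma cyl_self: "u \<in> cyl u n"
  by (simp add: cyl_def)

lemma openin_cantor_iff: "openin cantor U \<longleftrightarrow> (\<forall>x\<in>U. \<exists>n. cyl x n \<subseteq> U)"
proof
  assume U: "openin cantor U"
  show "\<forall>x\<in>U. \<exists>n. cyl x n \<subseteq> U"
  proof
    fix x assume "x \<in> U"
    with U obtain W where W: "finite {i. W i \<noteq> (UNIV::bit set)}" "x \<in> Pi\<^sub>E UNIV W" "Pi\<^sub>E UNIV W \<subseteq> U"
      unfolding cantor_def openin_product_topology_alt by force
    obtain n where n: "{i. W i \<noteq> UNIV} \<subseteq> {..<n}"
      using finite_nat_iff_bounded W(1) by blast
    have "z \<in> Pi\<^sub>E UNIV W" if z: "z \<in> cyl x n" for z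
    proof -
      have "z i \<in> W i" for i
      proof (cases "W i = UNIV")
        case False
        then have "z i = x i"
          using n z by (auto simp: cyl_def)
        then show ?thesis
          using W(2) by auto
      qed simp
      then show ?thesis
        by auto
    qed
    then show "\<exists>n. cyl x n \<subseteq> U"
      using W(3) by blast
  qed
next
  assume *: "\<forall>x\<in>U. \<exists>n. cyl x n \<subseteq> U"
  show "openin cantor U"
    unfolding cantor_def openin_product_topology_alt
  proof (clarsimp)
    fix x assume "x \<in> U"
    with * obtain n where n: "cyl x n \<subseteq> U"
      by blast
    let ?W = "\<lambda>i. if i < n then {x i} else UNIV"
    have "Pi\<^sub>E UNIV ?W \<subseteq> cyl x n"
    proof
      fix z assume z: "z \<in> Pi\<^sub>E UNIV ?W"
      have "z i = x i" if "i < n" for i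
        using PiE_mem[OF z, of i] that by simp
      then show "z \<in> cyl x n"
        by (simp add: cyl_def)
    qed
    then have sub: "Pi\<^sub>E UNIV ?W \<subseteq> U"
      using n by (rule subset_trans)
    have fin: "finite {i. ?W i \<noteq> UNIV}"
      by (rule finite_subset[of _ "{..<n}"]) auto
    have "x \<in> Pi\<^sub>E UNIV ?W"
      by (rule PiE_I) simp_all
    with fin sub show "\<exists>W. finite {i. W i \<noteq> UNIV} \<and> x \<in> Pi\<^sub>E UNIV W \<and> Pi\<^sub>E UNIV W \<subseteq> U"
      by (intro exI[of _ ?W] conjI)
  qed
qed

lemma openin_cyl: "openin cantor (cyl u n)"
  unfolding openin_cantor_iff
proof
  fix x assume "x \<in> cyl u n"
  then have "cyl x n \<subseteq> cyl u n"
    by (auto simp: cyl_def)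
  then show "\<exists>m. cyl x m \<subseteq> cyl u n" ..
qed

text \<open>A cylinder cannot lie inside the closure of \<open>N\<close>, so it has a point with a
  neighbourhood missing \<open>N\<close>. Lengthening a cylinder shrinks it, which gives
  \<open>n \<le> m\<close>; thus later constructions extend patterns in stages and keep what is
  already fixed.\<close>

lemma nowhere_dense_in_cantor_iff:
  "nowhere_dense_in cantor N \<longleftrightarrow> (\<forall>u n. \<exists>v m. n \<le> m \<and> v \<in> cyl u n \<and> cyl v m \<inter> N = {})"
proof
  assume N: "nowhere_dense_in cantor N"
  show "\<forall>u n. \<exists>v m. n \<le> m \<and> v \<in> cyl u n \<and> cyl v m \<inter> N = {}"
  proof (intro allI)
    fix u n
    have "\<not> cyl u n \<subseteq> cantor closure_of N"
      using interior_of_maximal[OF _ openin_cyl[of u n]] cyl_self[of u n] N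
      by (auto simp: nowhere_dense_in_def)
    then obtain v where v: "v \<in> cyl u n" "v \<notin> cantor closure_of N"
      by blast
    then obtain T where T: "v \<in> T" "openin cantor T" "T \<inter> N = {}"
      by (auto simp: in_closure_of topspace_cantor)
    then obtain k where k: "cyl v k \<subseteq> T"
      unfolding openin_cantor_iff by blast
    have "cyl v (max n k) \<subseteq> cyl v k"
      by (auto simp: cyl_def)
    then have "cyl v (max n k) \<inter> N = {}"
      using k T(3) by blast
    then show "\<exists>v m. n \<le> m \<and> v \<in> cyl u n \<and> cyl v m \<inter> N = {}"
      using v(1) by (meson max.cobounded1)
  qed
next
  assume *: "\<forall>u n. \<exists>v m. n \<le> m \<and> v \<in> cyl u n \<and> cyl v m \<inter> N = {}"
  have "u \<notin> cantor interior_of (cantor closure_of N)" for u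
  proof
    assume "u \<in> cantor interior_of (cantor closure_of N)"
    then obtain n where n: "cyl u n \<subseteq> cantor interior_of (cantor closure_of N)"
      using openin_interior_of[of cantor] unfolding openin_cantor_iff by blast
    obtain v m where v: "v \<in> cyl u n" "cyl v m \<inter> N = {}"
      using * by blast
    then have "v \<in> cantor closure_of N"
      using n interior_of_subset[of cantor "cantor closure_of N"] by blast
    then have "\<exists>y. y \<in> N \<and> y \<in> cyl v m"
      unfolding in_closure_of using openin_cyl[of v m] cyl_self[of v m] by simp
    with v(2) show False
      by blast
  qed
  then have "cantor interior_of (cantor closure_of N) = {}"
    by blast
  then show "nowhere_dense_in cantor N"
    by (simp add: nowhere_dense_in_def topspace_cantor)
qed

lemma nowhere_dense_in_cantor_subset:
  assumes "nowhere_dense_in cantor N" and "M \<subseteq> N"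
  shows "nowhere_dense_in cantor M"
  using assms(1) interior_of_mono[OF closure_of_mono[OF assms(2)], of cantor cantor]
  by (auto simp: nowhere_dense_in_def topspace_cantor)

text \<open>Since \<open>meager_in\<close> asks for equality with a countable union, the covering
  sets are cut down to \<open>A\<close>.\<close>

lemma meager_in_cantorI:
  fixes B :: "nat \<Rightarrow> (nat \<Rightarrow> bit) set"
  assumes "\<And>k. nowhere_dense_in cantor (B k)" and "A \<subseteq> (\<Union>k. B k)"
  shows "meager_in cantor A"
  unfolding meager_in_def
proof (intro exI conjI)
  show "countable (range (\<lambda>k. A \<inter> B k))"
    by simp
  show "\<forall>N\<in>range (\<lambda>k. A \<inter> B k). nowhere_dense_in cantor N"
    using assms(1) nowhere_dense_in_cantor_subset by blast
  show "A = \<Union> (range (\<lambda>k. A \<inter> B k))"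
    using assms(2) by blast
qed

section \<open>Binary patterns on intervals and the block form of meager sets\<close>

definition supp_in :: "nat \<Rightarrow> nat \<Rightarrow> (nat \<Rightarrow> bit) set" where
  "supp_in a b = {z. \<forall>i. \<not> (a \<le> i \<and> i < b) \<longrightarrow> z i = 0}"

text \<open>Binary sequences on \<open>[a, b)\<close> are represented by total functions vanishing
  elsewhere, the elements of \<open>supp_in a b\<close>; \<open>trunc\<close> then serves as
  restriction.\<close>

definition trunc :: "nat \<Rightarrow> nat \<Rightarrow> (nat \<Rightarrow> bit) \<Rightarrow> nat \<Rightarrow> bit" where
  "trunc a b x = (\<lambda>i. if a \<le> i \<and> i < b then x i else 0)"

lemma trunc_in_supp_in: "trunc a b x \<in> supp_in a b"
  by (simp add: trunc_def supp_in_def)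

lemma finite_supp_in: "finite (supp_in a b)"
proof (rule finite_subset)
  show "supp_in a b \<subseteq> (\<lambda>S i. if i \<in> S then 1 else 0) ` Pow {a..<b}"
  proof
    fix z assume z: "z \<in> supp_in a b"
    have "z = (\<lambda>i. if i \<in> {i. z i = 1} then 1 else 0)"
      by (auto simp: fun_eq_iff)
    moreover have "{i. z i = 1} \<in> Pow {a..<b}"
      using z by (force simp: supp_in_def)
    ultimately show "z \<in> (\<lambda>S i. if i \<in> S then 1 else 0) ` Pow {a..<b}"
      by (rule image_eqI)
  qed
qed simp

lemma card_supp_in_pos: "0 < card (supp_in a b)"
  using finite_supp_in trunc_in_supp_in by (metis card_gt_0_iff empty_iff)

lemma card_supp_in_ge_2:
  assumes "a < b"
  shows "2 \<le> card (supp_in a b)"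
proof -
  have "trunc a b (\<lambda>_. 0) \<noteq> trunc a b (\<lambda>_. 1)"
    using assms by (auto simp: trunc_def fun_eq_iff)
  then have "2 = card {trunc a b (\<lambda>_. 0), trunc a b (\<lambda>_. 1)}"
    by simp
  also have "\<dots> \<le> card (supp_in a b)"
    by (rule card_mono) (auto simp: finite_supp_in trunc_in_supp_in)
  finally show ?thesis .
qed

text \<open>One pattern \<open>s\<close> on \<open>[n, m)\<close> works for all stems
  \<open>t\<close> and sets \<open>N\<close> in \<open>Q\<close>: the pairs are treated one after
  another, and prolonging \<open>s\<close> for a new pair preserves the avoidance obtained for the
  earlier ones.\<close>

lemma finite_nowhere_dense_avoid:
  assumes "finite Q" and "\<And>t N. (t, N) \<in> Q \<Longrightarrow> nowhere_dense_in cantor N"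
  shows "\<exists>m s. n < m \<and>
    (\<forall>(t, N)\<in>Q. \<forall>z. (\<forall>i<n. z i = t i) \<longrightarrow> (\<forall>i. n \<le> i \<and> i < m \<longrightarrow> z i = s i) \<longrightarrow> z \<notin> N)"
  using assms
proof (induction Q rule: finite_induct)
  case empty
  then show ?case by auto
next
  case (insert q Q)
  obtain t N where q: "q = (t, N)"
    by (cases q)
  obtain m s where ms: "n < m" "\<forall>(t, N)\<in>Q. \<forall>z. (\<forall>i<n. z i = t i) \<longrightarrow>
      (\<forall>i. n \<le> i \<and> i < m \<longrightarrow> z i = s i) \<longrightarrow> z \<notin> N"
    using insert by (meson insertCI)
  have "nowhere_dense_in cantor N"
    using insert.prems q by blast
  \<comment> \<open>The cylinder is given by the new stem followed by the pattern found so far, so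
    \<open>v\<close> prolongs \<open>s\<close> on \<open>[n, m)\<close>.\<close>
  then obtain v k where v: "m \<le> k" "v \<in> cyl (\<lambda>i. if i < n then t i else s i) m" "cyl v k \<inter> N = {}"
    unfolding nowhere_dense_in_cantor_iff by blast
  have vt: "v i = t i" if "i < n" for i
    using v(2) ms(1) that by (simp add: cyl_def)
  have vs: "v i = s i" if "n \<le> i" "i < m" for i
    using v(2) that by (simp add: cyl_def)
  have "z \<notin> N'" if tN: "(t', N') \<in> insert q Q" and z1: "\<forall>i<n. z i = t' i"
    and z2: "\<forall>i. n \<le> i \<and> i < k \<longrightarrow> z i = v i" for t' N' z
  proof (cases "(t', N') = q")
    case True
    have "z i = v i" if "i < k" for i
      using True q vt z1 z2 that by (cases "i < n") auto
    then have "z \<in> cyl v k"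
      by (simp add: cyl_def)
    then show ?thesis
      using v(3) True q by blast
  next
    case False
    moreover have "\<forall>i. n \<le> i \<and> i < m \<longrightarrow> z i = s i"
      using z2 vs v(1) by auto
    ultimately show ?thesis
      using ms(2) tN z1 by blast
  qed
  then show ?case
    using ms(1) v(1) by (intro exI[of _ k] exI[of _ v]) auto
qed

lemma glue_blocks:
  fixes f :: "nat \<Rightarrow> nat" and S :: "nat \<Rightarrow> nat \<Rightarrow> 'a"
  assumes "strict_mono f"
  obtains w where "\<And>k i. f k \<le> i \<Longrightarrow> i < f (Suc k) \<Longrightarrow> w i = S k i"
proof
  fix k i assume i: "f k \<le> i" "i < f (Suc k)"
  \<comment> \<open>The witness for \<open>w\<close> looks up \<open>S\<close> at the index of the
    block containing \<open>i\<close>, and this least \<open>j\<close> is that index.\<close>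
  have "(LEAST j. i < f (Suc j)) = k"
  proof (rule Least_equality)
    fix j assume "i < f (Suc j)"
    then have "f k < f (Suc j)"
      using i by simp
    then show "k \<le> j"
      using strict_mono_less[OF assms] by simp
  qed (rule i)
  then show "S (LEAST j. i < f (Suc j)) i = S k i"
    by simp
qed

text \<open>On block \<open>k\<close>, \<open>w\<close> is a pattern that keeps every point copying
  it out of \<open>N 0\<close>, ..., \<open>N k\<close>, whatever precedes the block. So a member of
  \<open>N j\<close> differs from \<open>w\<close> on all blocks from \<open>j\<close> on.\<close>

lemma meager_in_cantor_blocks:
  assumes "meager_in cantor A"
  obtains f :: "nat \<Rightarrow> nat" and w where "strict_mono f"
    "\<forall>a\<in>A. \<exists>k0. \<forall>k\<ge>k0. \<exists>i. f k \<le> i \<and> i < f (Suc k) \<and> a i \<noteq> w i"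
proof -
  obtain \<N> where \<N>: "countable \<N>" "\<forall>N\<in>\<N>. nowhere_dense_in cantor N" "A = \<Union>\<N>"
    using assms unfolding meager_in_def by blast
  \<comment> \<open>Adding the empty set makes the family nonempty, so that it can be enumerated by
    \<open>nat\<close>.\<close>
  have "nowhere_dense_in cantor {}"
    using zero_nowhere_dense nowhere_dense_in_cantor_subset by blast
  then have nd: "\<forall>M\<in>insert {} \<N>. nowhere_dense_in cantor M"
    using \<N>(2) by blast
  define N where "N = from_nat_into (insert {} \<N>)"
  have range_N: "range N = insert {} \<N>"
    unfolding N_def using \<N>(1) by (intro range_from_nat_into) auto
  have N: "nowhere_dense_in cantor (N j)" for j
    using nd range_N by blast
  have "\<exists>m s. n < m \<and> (\<forall>z. (\<forall>i. n \<le> i \<and> i < m \<longrightarrow> z i = s i) \<longrightarrow> (\<forall>j\<le>k. z \<notin> N j))" for n k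
  proof -
    let ?Q = "supp_in 0 n \<times> N ` {..k}"
    obtain m s where ms: "n < m" "\<forall>(t, N)\<in>?Q. \<forall>z. (\<forall>i<n. z i = t i) \<longrightarrow>
        (\<forall>i. n \<le> i \<and> i < m \<longrightarrow> z i = s i) \<longrightarrow> z \<notin> N"
      using finite_nowhere_dense_avoid[of ?Q n] N finite_supp_in by blast
    have "z \<notin> N j" if "\<forall>i. n \<le> i \<and> i < m \<longrightarrow> z i = s i" "j \<le> k" for z j
    proof -
      have "(trunc 0 n z, N j) \<in> ?Q"
        using that(2) trunc_in_supp_in by blast
      moreover have "\<forall>i<n. z i = trunc 0 n z i"
        by (simp add: trunc_def)
      ultimately show ?thesis
        using ms(2) that(1) by blast
    qed
    then show ?thesis
      using ms(1) by blast
  qed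
  then obtain M S where MS: "\<And>n k. n < M n k"
    "\<And>n k z j. (\<forall>i. n \<le> i \<and> i < M n k \<longrightarrow> z i = S n k i) \<Longrightarrow> j \<le> k \<Longrightarrow> z \<notin> N j"
    by metis
  define f where "f = rec_nat 0 (\<lambda>k n. M n k)"
  have f: "f (Suc k) = M (f k) k" for k
    by (simp add: f_def)
  have mono: "strict_mono f"
    unfolding strict_mono_Suc_iff using MS(1) f by simp
  obtain w where w: "\<And>k i. f k \<le> i \<Longrightarrow> i < f (Suc k) \<Longrightarrow> w i = S (f k) k i"
    using glue_blocks[OF mono, where S = "\<lambda>k. S (f k) k"] by blast
  show thesis
  proof (rule that[OF mono, of w], rule ballI)
    fix a assume "a \<in> A"
    then have "a \<in> \<Union> (range N)"
      using \<N>(3) range_N by auto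
    then obtain j where j: "a \<in> N j"
      by blast
    have "\<exists>i. f k \<le> i \<and> i < f (Suc k) \<and> a i \<noteq> w i" if "j \<le> k" for k
    proof (rule ccontr)
      assume "\<not> ?thesis"
      then have "\<forall>i. f k \<le> i \<and> i < M (f k) k \<longrightarrow> a i = S (f k) k i"
        using w f by metis
      then show False
        using MS(2) that j by blast
    qed
    then show "\<exists>k0. \<forall>k\<ge>k0. \<exists>i. f k \<le> i \<and> i < f (Suc k) \<and> a i \<noteq> w i"
      by blast
  qed
qed

text \<open>As \<open>D\<close> is infinite, any cylinder can be prolonged to the start of a late
  block with index in \<open>D\<close>; copying \<open>v\<close> on that block leaves the
  set.\<close>

lemma nowhere_dense_differ_on_blocks:
  fixes F :: "nat \<Rightarrow> nat"
  assumes "strict_mono F" and "infinite D"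
  shows "nowhere_dense_in cantor
    {z. \<forall>n\<in>D. n0 \<le> n \<longrightarrow> (\<exists>i. F n \<le> i \<and> i < F (Suc n) \<and> z i \<noteq> v i)}"
  unfolding nowhere_dense_in_cantor_iff
proof (intro allI)
  fix u m
  obtain n where n: "n \<in> D" "max n0 m \<le> n"
    using assms(2) infinite_nat_iff_unbounded_le by blast
  have Fn: "m \<le> F n" "F n < F (Suc n)"
    using n(2) strict_mono_imp_increasing[OF assms(1), of n] strict_monoD[OF assms(1), of n "Suc n"]
    by auto
  let ?u = "\<lambda>i. if i < F n then u i else v i"
  have "?u \<in> cyl u m"
    using Fn(1) by (simp add: cyl_def)
  moreover have "cyl ?u (F (Suc n)) \<inter>
      {z. \<forall>n\<in>D. n0 \<le> n \<longrightarrow> (\<exists>i. F n \<le> i \<and> i < F (Suc n) \<and> z i \<noteq> v i)} = {}"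
    using n by (fastforce simp: cyl_def)
  moreover have "m \<le> F (Suc n)"
    using Fn by simp
  ultimately show "\<exists>v' k. m \<le> k \<and> v' \<in> cyl u m \<and> cyl v' k \<inter>
      {z. \<forall>n\<in>D. n0 \<le> n \<longrightarrow> (\<exists>i. F n \<le> i \<and> i < F (Suc n) \<and> z i \<noteq> v i)} = {}"
    by blast
qed

section \<open>From predictors of coded sequences to meagerness of \<open>A + X\<close>\<close>

lemma not_meager_additive_imp_evading_family:
  assumes "X \<notin> MA"
  obtains b :: "nat \<Rightarrow> nat" and code :: "(nat \<Rightarrow> bit) \<Rightarrow> nat \<Rightarrow> nat"
  where "\<forall>n. 2 \<le> b n" "code ` X \<subseteq> Prod_seq b"
    "\<not> (\<exists>p. predictor b p \<and> (\<forall>f\<in>code ` X. predicts p f))"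
proof -
  obtain A where A: "meager_in cantor A" "\<not> meager_in cantor (set_add A X)"
    using assms unfolding MA_def by blast
  obtain f w where f: "strict_mono f"
    and w: "\<forall>a\<in>A. \<exists>k0. \<forall>k\<ge>k0. \<exists>i. f k \<le> i \<and> i < f (Suc k) \<and> a i \<noteq> w i"
    by (rule meager_in_cantor_blocks[OF A(1)])
  \<comment> \<open>\<open>l n\<close> is the index of the first block of \<open>f\<close> in the
    \<open>n\<close>-th superblock, which starts at \<open>F n = f (l n)\<close>. The increment
    counts the binary sequences of length \<open>F n\<close>, so each past gets a block of its
    own.\<close>
  define l where "l = rec_nat 0 (\<lambda>_ k. k + card (supp_in 0 (f k)))"
  have l: "l (Suc n) = l n + card (supp_in 0 (f (l n)))" for n
    by (simp add: l_def)
  have lmono: "strict_mono l"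
    unfolding strict_mono_Suc_iff using l card_supp_in_pos by simp
  define F where "F n = f (l n)" for n
  have Fmono: "strict_mono F"
    using f lmono unfolding F_def strict_mono_def by blast
  have "\<exists>h. bij_betw h (supp_in a b) {0..<card (supp_in a b)}" for a b
    by (rule ex_bij_betw_finite_nat[OF finite_supp_in])
  then obtain h where h: "\<And>a b. bij_betw (h a b) (supp_in a b) {0..<card (supp_in a b)}"
    by metis
  have h_less: "h a b (trunc a b x) < card (supp_in a b)" for a b x
    using bij_betwE[OF h] trunc_in_supp_in by fastforce
  define d where "d a b = inv_into (supp_in a b) (h a b)" for a b
  have d: "d a b (h a b (trunc a b x)) = trunc a b x" for a b x
    unfolding d_def by (rule bij_betw_inv_into_left[OF h trunc_in_supp_in])
  define b where "b n = card (supp_in (F n) (F (Suc n)))" for n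
  define code where "code x n = h (F n) (F (Suc n)) (trunc (F n) (F (Suc n)) x)" for x n
  \<comment> \<open>The first \<open>n\<close> code values depend only on \<open>x\<close> below
    \<open>F n\<close>. Hence a past, and so its number, determines what the predictor sees at
    \<open>n\<close>.\<close>
  have past: "restr (code (trunc 0 (F n) x)) n = restr (code x) n" for n x
  proof -
    have "trunc (F i) (F (Suc i)) (trunc 0 (F n) x) = trunc (F i) (F (Suc i)) x" if "i < n" for i
    proof -
      have "F (Suc i) \<le> F n"
        using that strict_mono_less_eq[OF Fmono] by simp
      then show ?thesis
        by (auto simp: trunc_def fun_eq_iff)
    qed
    then show ?thesis
      by (simp add: restr_def code_def)
  qed
  show thesis
  proof (rule that[of b code])
    show "\<forall>n. 2 \<le> b n"
      unfolding b_def using card_supp_in_ge_2 strict_monoD[OF Fmono] by simp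
    show "code ` X \<subseteq> Prod_seq b"
      using h_less by (auto simp: Prod_seq_def code_def b_def)
    show "\<not> (\<exists>p. predictor b p \<and> (\<forall>f\<in>code ` X. predicts p f))"
    proof
      assume "\<exists>p. predictor b p \<and> (\<forall>f\<in>code ` X. predicts p f)"
      then obtain D \<pi> where D: "infinite D" and pred: "\<And>x. x \<in> X \<Longrightarrow> predicts (D, \<pi>) (code x)"
        by (auto simp: predictor_def)
      \<comment> \<open>\<open>Y n j\<close> is the pattern on the \<open>n\<close>-th superblock
        that \<pi> predicts from the past with number \<open>j\<close>.\<close>
      define Y where "Y n j = d (F n) (F (Suc n)) (\<pi> (restr (code (d 0 (F n) j)) n))" for n j
      \<comment> \<open>Two gluings: \<open>Z\<close> gives block number \<open>l n + j\<close> the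
        pattern \<open>Y n j\<close>, and \<open>y\<close> copies \<open>Z k\<close> on block
        \<open>k\<close>.\<close>
      obtain Z where Z: "\<And>n k. l n \<le> k \<Longrightarrow> k < l (Suc n) \<Longrightarrow> Z k = Y n (k - l n)"
        using glue_blocks[OF lmono, where S = "\<lambda>n k. Y n (k - l n)"] by blast
      obtain y where y: "\<And>k i. f k \<le> i \<Longrightarrow> i < f (Suc k) \<Longrightarrow> y i = Z k i"
        using glue_blocks[OF f, where S = Z] by blast
      have guess: "\<exists>k. l n \<le> k \<and> k < l (Suc n) \<and> (\<forall>i. f k \<le> i \<and> i < f (Suc k) \<longrightarrow> x i = y i)"
        if n: "code x n = \<pi> (restr (code x) n)" for x n
      proof -
        \<comment> \<open>\<open>?j\<close> is the number of the actual past of \<open>x\<close>, so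
          on block \<open>?k\<close> the sequence \<open>y\<close> follows the correct prediction
          for \<open>x\<close>.\<close>
        let ?j = "h 0 (F n) (trunc 0 (F n) x)"
        let ?k = "l n + ?j"
        have k: "l n \<le> ?k" "?k < l (Suc n)"
          using h_less by (auto simp: l F_def)
        have "Y n ?j = trunc (F n) (F (Suc n)) x"
          by (simp add: Y_def d past n[symmetric]) (simp add: code_def d)
        then have Zk: "Z ?k = trunc (F n) (F (Suc n)) x"
          using Z[OF k] by simp
        have "x i = y i" if i: "f ?k \<le> i" "i < f (Suc ?k)" for i
        proof -
          have "F n \<le> f ?k" "f (Suc ?k) \<le> F (Suc n)"
            using k strict_mono_less_eq[OF f] by (auto simp: F_def)
          then show ?thesis
            using i y[OF i] Zk by (simp add: trunc_def)
        qed
        then show ?thesis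
          using k by blast
      qed
      \<comment> \<open>\<open>n0\<close> absorbs the finitely many exceptions, both of the
        prediction and of \<open>a\<close> differing from \<open>w\<close>; countably many sets
        \<open>B n0\<close> then cover \<open>A + X\<close>.\<close>
      define B where "B n0 = {z. \<forall>n\<in>D. n0 \<le> n \<longrightarrow>
        (\<exists>i. F n \<le> i \<and> i < F (Suc n) \<and> z i \<noteq> w i + y i)}" for n0
      have "set_add A X \<subseteq> (\<Union>n0. B n0)"
      proof
        fix z assume "z \<in> set_add A X"
        then obtain a x where z: "z = (\<lambda>n. a n + x n)" "a \<in> A" "x \<in> X"
          by (auto simp: set_add_def)
        obtain k0 where k0: "\<And>k. k0 \<le> k \<Longrightarrow> \<exists>i. f k \<le> i \<and> i < f (Suc k) \<and> a i \<noteq> w i"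
          using w z(2) by blast
        have "finite {n \<in> D. code x n \<noteq> \<pi> (restr (code x) n)}"
          using pred[OF z(3)] by (simp add: predicts_def)
        then obtain n1 where n1: "{n \<in> D. code x n \<noteq> \<pi> (restr (code x) n)} \<subseteq> {..<n1}"
          using finite_nat_iff_bounded by blast
        have "z \<in> B (max k0 n1)"
          unfolding B_def
        proof (intro CollectI ballI impI)
          fix n assume n: "n \<in> D" "max k0 n1 \<le> n"
          then have "code x n = \<pi> (restr (code x) n)"
            using n1 by auto
          then obtain k where k: "l n \<le> k" "k < l (Suc n)"
            and xy: "\<forall>i. f k \<le> i \<and> i < f (Suc k) \<longrightarrow> x i = y i"
            using guess by blast
          \<comment> \<open>\<open>k0 \<le> n \<le> l n \<le> k\<close>, as \<open>l\<close> is
            strictly increasing. So \<open>a\<close> differs from \<open>w\<close> on the very block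
            where \<open>x\<close> agrees with \<open>y\<close>.\<close>
          have "k0 \<le> k"
            using n(2) k(1) strict_mono_imp_increasing[OF lmono, of n] by simp
          then obtain i where i: "f k \<le> i" "i < f (Suc k)" "a i \<noteq> w i"
            using k0 by blast
          have "f (l n) \<le> f k" "f (Suc k) \<le> f (l (Suc n))"
            using k strict_mono_less_eq[OF f] by auto
          then have "F n \<le> i" "i < F (Suc n)"
            unfolding F_def using i(1,2) by linarith+
          moreover have "x i = y i"
            using xy i(1,2) by blast
          then have "z i \<noteq> w i + y i"
            unfolding z(1) using i(3) by (simp only: add_right_cancel not_False_eq_True)
          ultimately show "\<exists>i. F n \<le> i \<and> i < F (Suc n) \<and> z i \<noteq> w i + y i"
            by blast
        qed
        then show "z \<in> (\<Union>n0. B n0)"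
          by (rule UN_I[OF UNIV_I])
      qed
      then have "meager_in cantor (set_add A X)"
        by (rule meager_in_cantorI[of B, rotated])
          (unfold B_def, rule nowhere_dense_differ_on_blocks[OF Fmono D])
      with A(2) show False ..
    qed
  qed
qed

theorem theorem5p8:
  shows "e_ubd \<le>o non MA"
proof -
  obtain X :: "(nat \<Rightarrow> bit) set" where X: "X \<notin> MA" "non MA = |X|"
    using non_MA_least by blast
  obtain b code where b: "\<forall>n. 2 \<le> b n" and code: "code ` X \<subseteq> Prod_seq b"
    "\<not> (\<exists>p. predictor b p \<and> (\<forall>f\<in>code ` X. predicts p f))"
    by (rule not_meager_additive_imp_evading_family[OF X(1)])
  have "e_ubd \<le>o e_L1 b"
    using e_ubd_least b by blast
  also have "e_L1 b \<le>o |code ` X|"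
    using e_L1_least[OF b] code by blast
  also have "|code ` X| \<le>o |X|"
    by (rule card_of_image)
  finally show ?thesis
    unfolding X(2) .
qed

end
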